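(* For any connected graph $G$ with $n\geq 3$ vertices and $m$ edges, $\gamma_{\rm wcon}(G)\leq 2m-n$, with equality if and only if $G$ is a path or a cycle $C_p$ with $p\geq 7$.
   Context: Graphs are finite, simple, undirected. A set $X\subseteq V(G)$ is weakly convex if for any two vertices $a,b\in X$ there is a shortest $(a-b)$-path in $G$ all of whose vertices lie in $X$; it is dominating if every vertex outside $X$ has a neighbour in $X$. $\gamma_{\rm wcon}(G)$ is the minimum cardinality of a weakly convex dominating set of $G$. *)

theory Defs
  imports "Graph_Theory.Graph_Theory"
begin

text \<open>
  A finite simple undirected graph is an instance of the locale \<^locale>\<open>graph\<close>: a finite symmetric
  digraph without loops and without parallel arcs. An undirected edge is thus a pair of
  opposite arcs, so edges are counted as two-element vertex sets rather than as arcs.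
\<close>

definition uedges :: "('a, 'b) pre_digraph \<Rightarrow> 'a set set" where
  "uedges G = {{u, v} | u v. u \<rightarrow>\<^bsub>G\<^esub> v}"

definition vpath_between :: "('a, 'b) pre_digraph \<Rightarrow> 'a \<Rightarrow> 'a vwalk \<Rightarrow> 'a \<Rightarrow> bool" where
  "vpath_between G a p b \<longleftrightarrow> vpath p G \<and> hd p = a \<and> last p = b"

definition shortest_vpath :: "('a, 'b) pre_digraph \<Rightarrow> 'a \<Rightarrow> 'a vwalk \<Rightarrow> 'a \<Rightarrow> bool" where
  "shortest_vpath G a p b \<longleftrightarrow> vpath_between G a p b \<and>
     (\<forall>q. vpath_between G a q b \<longrightarrow> vwalk_length p \<le> vwalk_length q)"

definition weakly_convex :: "('a, 'b) pre_digraph \<Rightarrow> 'a set \<Rightarrow> bool" where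
  "weakly_convex G X \<longleftrightarrow> X \<subseteq> verts G \<and>
     (\<forall>a\<in>X. \<forall>b\<in>X. \<exists>p. shortest_vpath G a p b \<and> set p \<subseteq> X)"

definition dominating_set :: "('a, 'b) pre_digraph \<Rightarrow> 'a set \<Rightarrow> bool" where
  "dominating_set G X \<longleftrightarrow> X \<subseteq> verts G \<and> (\<forall>v \<in> verts G - X. \<exists>u\<in>X. v \<rightarrow>\<^bsub>G\<^esub> u)"

text \<open>
  For a finite connected graph the minimum is taken over a finite nonempty set, see
  \<open>wcon_dominating_verts\<close> below; for a disconnected graph it may be unspecified.
\<close>

definition gamma_wcon :: "('a, 'b) pre_digraph \<Rightarrow> nat" where
  "gamma_wcon G = Min (card ` {X. weakly_convex G X \<and> dominating_set G X})"

definition path_graph :: "nat \<Rightarrow> nat pair_pre_digraph" where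
  "path_graph n = \<lparr> pverts = {..<n},
     parcs = {(i, j). i < n \<and> j < n \<and> (j = i + 1 \<or> i = j + 1)} \<rparr>"

text \<open>Only meaningful as a simple graph for \<open>p \<ge> 3\<close>.\<close>

definition cycle_graph :: "nat \<Rightarrow> nat pair_pre_digraph" where
  "cycle_graph p = \<lparr> pverts = {..<p},
     parcs = {(i, j). i < p \<and> j < p \<and> (j = (i + 1) mod p \<or> i = (j + 1) mod p)} \<rparr>"

lemma pair_graph_path_graph: "pair_graph (path_graph n)"
proof -
  have "finite (parcs (path_graph n))"
    by (rule finite_subset[of _ "{..<n} \<times> {..<n}"]) (auto simp: path_graph_def)
  then show ?thesis
    by unfold_locales (auto simp: path_graph_def symmetric_def sym_def)
qed

lemma pair_graph_cycle_graph:
  assumes "p \<ge> 3"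
  shows "pair_graph (cycle_graph p)"
proof -
  have "finite (parcs (cycle_graph p))"
    by (rule finite_subset[of _ "{..<p} \<times> {..<p}"]) (auto simp: cycle_graph_def)
  moreover have "(i + 1) mod p \<noteq> i" if "i < p" for i
    using that assms by (cases "i + 1 = p") auto
  ultimately show ?thesis
    by unfold_locales (fastforce simp: cycle_graph_def symmetric_def sym_def)+
qed

lemma wcon_dominating_verts:
  assumes "graph G" and "Digraph_Component.connected G"
  shows "weakly_convex G (verts G)" and "dominating_set G (verts G)"
proof -
  interpret graph G by fact
  have "\<exists>p. shortest_vpath G a p b \<and> set p \<subseteq> verts G" if "a \<in> verts G" "b \<in> verts G" for a b
  proof -
    have "a \<rightarrow>\<^sup>*\<^bsub>G\<^esub> b"
      using assms(2) that reachable_mk_symmetric_eq[OF sym_arcs]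
      by (simp add: connected_def strongly_connected_def)
    then obtain p where "vpath_between G a p b"
      unfolding vpath_between_def reachable_vpath_conv by blast
    then obtain p where "vpath_between G a p b"
      "\<forall>q. vpath_between G a q b \<longrightarrow> vwalk_length p \<le> vwalk_length q"
      using ex_has_least_nat[of "\<lambda>p. vpath_between G a p b" _ vwalk_length] by blast
    then show ?thesis
      unfolding shortest_vpath_def by (auto simp: vpath_between_def vpath_def vwalk_def)
  qed
  then show "weakly_convex G (verts G)" by (auto simp: weakly_convex_def)
  show "dominating_set G (verts G)" by (auto simp: dominating_set_def)
qed

end

theory Submission
  imports Defs
begin

text \<open>
  The non-leaves of \<open>G\<close> form a weakly convex dominating set: an inner vertex of a path has two
  neighbours, and two adjacent leaves would be a whole component. Every leaf has degree 1 and every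
  other vertex degree at least 2, so with \<open>l\<close> leaves the degree sum yields
  \<open>2 m \<ge> l + 2 (n - l) = 2 n - l\<close>, hence \<open>\<gamma> \<le> n - l \<le> 2 m - n\<close>. Equality forces maximum degree 2,
  and then a longest path spans \<open>G\<close>, which is a path or a cycle. It remains to evaluate \<open>\<gamma>\<close> on
  these two families: a weakly convex dominating set of a path contains all its inner vertices, and
  one of \<open>C\<^sub>p\<close> with \<open>p \<ge> 7\<close> that missed a vertex \<open>v\<close> would contain two vertices at distance at most 3
  (through \<open>v\<close>) which cannot be joined by fewer than 4 edges avoiding \<open>v\<close>.
\<close>

section \<open>Walks and shortest paths\<close>

lemma set_vwalk_arcs: "set (vwalk_arcs p) = {(p ! i, p ! Suc i) | i. Suc i < length p}"
proof (induction p rule: vwalk_arcs.induct)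
  case (3 x y xs)
  \<comment> \<open>Abstract \<open>f\<close> and \<open>g\<close> make this a pure split of the
    index range into 0 and the successors.\<close>
  have "{(f i, g i) | i. Suc i < length (x # y # xs)} =
      insert (f 0, g 0) {(f (Suc i), g (Suc i)) | i. Suc i < length (y # xs)}"
    for f g :: "nat \<Rightarrow> 'a"
    by (auto simp: less_Suc_eq_0_disj)
  from this[of "\<lambda>i. (x # y # xs) ! i" "\<lambda>i. (x # y # xs) ! Suc i"] 3 show ?case
    by simp
qed auto

lemma vwalk_iff_nth:
  "vwalk p G \<longleftrightarrow> p \<noteq> [] \<and> set p \<subseteq> verts G \<and>
    (\<forall>i. Suc i < length p \<longrightarrow> p ! i \<rightarrow>\<^bsub>G\<^esub> p ! Suc i)"
  by (auto simp: vwalk_def set_vwalk_arcs)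

text \<open>Telescoping over the arcs. Confining the walk to \<open>S\<close> admits an
  \<open>h\<close> that jumps elsewhere: on a cycle with vertex 0 left out, the vertex number itself
  qualifies.\<close>

lemma vwalk_lipschitz:
  fixes h :: "'a \<Rightarrow> int"
  assumes "vwalk p G" "set p \<subseteq> S"
    and "\<And>u v. u \<in> S \<Longrightarrow> v \<in> S \<Longrightarrow> u \<rightarrow>\<^bsub>G\<^esub> v \<Longrightarrow> \<bar>h u - h v\<bar> \<le> 1"
  shows "\<bar>h (hd p) - h (last p)\<bar> \<le> int (vwalk_length p)"
  using assms(1,2)
proof (induction p rule: vwalk_induct)
  case (Cons u v es)
  then have "\<bar>h u - h v\<bar> \<le> 1" using assms(3) by auto
  with Cons show ?case by (cases es) auto
qed auto

lemma vwalk_intermediate_value: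
  fixes h :: "'a \<Rightarrow> nat"
  assumes "vwalk p G"
    and "\<And>u v. u \<rightarrow>\<^bsub>G\<^esub> v \<Longrightarrow> h v \<le> Suc (h u)"
    and "h (hd p) \<le> c" "c \<le> h (last p)"
  shows "c \<in> h ` set p"
  using assms(1,3,4)
proof (induction p rule: vwalk_induct)
  case (Cons u v es)
  then have "h v \<le> Suc (h u)" using assms(2) by auto
  with Cons show ?case by (cases "h u = c") auto
qed auto

text \<open>A 1-Lipschitz \<open>h\<close> bounds the length of every walk from \<open>a\<close> to
  \<open>b\<close> from below, so it certifies a path that attains the bound.\<close>

lemma shortest_vpathI_lipschitz:
  fixes h :: "'a \<Rightarrow> int"
  assumes "vpath_between G a p b"
    and "\<And>u v. u \<rightarrow>\<^bsub>G\<^esub> v \<Longrightarrow> \<bar>h u - h v\<bar> \<le> 1"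
    and "int (vwalk_length p) \<le> \<bar>h a - h b\<bar>"
  shows "shortest_vpath G a p b"
  unfolding shortest_vpath_def
proof (intro conjI allI impI)
  fix q assume "vpath_between G a q b"
  then have "vwalk q G" "hd q = a" "last q = b"
    by (auto simp: vpath_between_def vpath_def)
  then have "\<bar>h a - h b\<bar> \<le> int (vwalk_length q)"
    using vwalk_lipschitz[of q G UNIV h] assms(2) by auto
  with assms(3) show "vwalk_length p \<le> vwalk_length q" by linarith
qed (fact assms(1))

section \<open>The domination number as a minimum\<close>

lemma finite_wcon_cards:
  assumes "finite (verts G)"
  shows "finite (card ` {X. weakly_convex G X \<and> dominating_set G X})"
  by (intro finite_imageI finite_subset[OF _ finite_Pow_iff[THEN iffD2, OF assms]])
    (auto simp: weakly_convex_def)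

lemma gamma_wcon_le:
  assumes "finite (verts G)" "weakly_convex G X" "dominating_set G X"
  shows "gamma_wcon G \<le> card X"
  unfolding gamma_wcon_def using assms finite_wcon_cards by (intro Min_le) auto

text \<open>A \<open>Min\<close> over a nonempty finite set is attained; connectedness makes
  \<open>verts G\<close> a candidate.\<close>

lemma gamma_wcon_ge:
  assumes "graph G" "Digraph_Component.connected G"
    and "\<And>X. weakly_convex G X \<Longrightarrow> dominating_set G X \<Longrightarrow> k \<le> card X"
  shows "k \<le> gamma_wcon G"
proof -
  interpret graph G by fact
  have "verts G \<in> {X. weakly_convex G X \<and> dominating_set G X}"
    using wcon_dominating_verts[OF assms(1,2)] by simp
  then have "gamma_wcon G \<in> card ` {X. weakly_convex G X \<and> dominating_set G X}"
    unfolding gamma_wcon_def by (intro Min_in finite_wcon_cards) auto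
  with assms(3) show ?thesis by auto
qed

section \<open>Isomorphisms\<close>

text \<open>Convexity, domination and edge counts depend only on vertices and adjacency. Dropping
  the arc bijection of \<open>digraph_iso\<close> leaves a relation that is easy to invert and to
  transport along.\<close>

definition vert_iso :: "('a, 'b) pre_digraph \<Rightarrow> ('a \<Rightarrow> 'c) \<Rightarrow> ('c, 'd) pre_digraph \<Rightarrow> bool" where
  "vert_iso G g H \<longleftrightarrow> bij_betw g (verts G) (verts H) \<and>
    (\<forall>u\<in>verts G. \<forall>v\<in>verts G. u \<rightarrow>\<^bsub>G\<^esub> v \<longleftrightarrow> g u \<rightarrow>\<^bsub>H\<^esub> g v)"

lemma vert_iso_inv:
  assumes "vert_iso G g H"
  shows "vert_iso H (inv_into (verts G) g) G"
proof -
  have bij: "bij_betw g (verts G) (verts H)" using assms by (simp add: vert_iso_def)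
  have "inv_into (verts G) g x \<in> verts G" "g (inv_into (verts G) g x) = x" if "x \<in> verts H" for x
    using bij that bij_betw_apply[OF bij_betw_inv_into] bij_betw_inv_into_right by metis+
  then show ?thesis
    using assms bij_betw_inv_into[OF bij] by (simp add: vert_iso_def)
qed

lemma vert_iso_vpath_between:
  assumes "vert_iso G g H" "vpath_between G a p b"
  shows "vpath_between H (g a) (map g p) (g b)"
proof -
  have p: "p \<noteq> []" "set p \<subseteq> verts G" "distinct p" "hd p = a" "last p = b"
    and arcs: "\<And>i. Suc i < length p \<Longrightarrow> p ! i \<rightarrow>\<^bsub>G\<^esub> p ! Suc i"
    using assms(2) by (auto simp: vpath_between_def vpath_def vwalk_iff_nth)
  have "inj_on g (set p)" "g ` set p \<subseteq> verts H"
    using assms(1) p(2) by (auto simp: vert_iso_def bij_betw_def inj_on_subset)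
  moreover have "g (p ! i) \<rightarrow>\<^bsub>H\<^esub> g (p ! Suc i)" if "Suc i < length p" for i
  proof -
    have "p ! i \<in> verts G" "p ! Suc i \<in> verts G"
      using that p(2) nth_mem[of i p] nth_mem[of "Suc i" p] by auto
    with arcs[OF that] assms(1) show ?thesis by (simp add: vert_iso_def)
  qed
  ultimately show ?thesis
    using p by (auto simp: vpath_between_def vpath_def vwalk_iff_nth distinct_map hd_map last_map)
qed

text \<open>A shorter competitor in \<open>H\<close> would pull back along the inverse of
  \<open>g\<close> to a path in \<open>G\<close> of the same length.\<close>

lemma vert_iso_shortest_vpath:
  assumes iso: "vert_iso G g H" and p: "shortest_vpath G a p b"
  shows "shortest_vpath H (g a) (map g p) (g b)"
  unfolding shortest_vpath_def
proof (intro conjI allI impI)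
  have between: "vpath_between G a p b" using p by (simp add: shortest_vpath_def)
  then show "vpath_between H (g a) (map g p) (g b)" by (rule vert_iso_vpath_between[OF iso])
  have "a \<in> set p" "b \<in> set p" "set p \<subseteq> verts G"
    using between by (auto simp: vpath_between_def vpath_def vwalk_def)
  then have "a \<in> verts G" "b \<in> verts G" by auto
  then have inv: "inv_into (verts G) g (g a) = a" "inv_into (verts G) g (g b) = b"
    using iso by (auto simp: vert_iso_def bij_betw_def)
  fix q assume "vpath_between H (g a) q (g b)"
  from vert_iso_vpath_between[OF vert_iso_inv[OF iso] this]
  have "vpath_between G a (map (inv_into (verts G) g) q) b" by (simp add: inv)
  then have "vwalk_length p \<le> vwalk_length (map (inv_into (verts G) g) q)"
    using p unfolding shortest_vpath_def by blast
  then show "vwalk_length (map g p) \<le> vwalk_length q" by simp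
qed

lemma vert_iso_weakly_convex:
  assumes iso: "vert_iso G g H" and X: "weakly_convex G X"
  shows "weakly_convex H (g ` X)"
  unfolding weakly_convex_def
proof (intro conjI ballI)
  show "g ` X \<subseteq> verts H"
    using iso X unfolding vert_iso_def weakly_convex_def bij_betw_def by blast
  fix c d assume "c \<in> g ` X" "d \<in> g ` X"
  then obtain a b where ab: "a \<in> X" "b \<in> X" "c = g a" "d = g b" by auto
  then obtain p where "shortest_vpath G a p b" "set p \<subseteq> X"
    using X unfolding weakly_convex_def by blast
  then show "\<exists>q. shortest_vpath H c q d \<and> set q \<subseteq> g ` X"
    using vert_iso_shortest_vpath[OF iso] ab by (intro exI[of _ "map g p"]) auto
qed

lemma vert_iso_dominating_set:
  assumes iso: "vert_iso G g H" and X: "dominating_set G X"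
  shows "dominating_set H (g ` X)"
  unfolding dominating_set_def
proof (intro conjI ballI)
  have sub: "X \<subseteq> verts G" using X by (simp add: dominating_set_def)
  then show "g ` X \<subseteq> verts H" using iso by (auto simp: vert_iso_def bij_betw_def)
  fix w assume "w \<in> verts H - g ` X"
  then obtain v where v: "v \<in> verts G - X" "w = g v"
    using iso unfolding vert_iso_def bij_betw_def by blast
  then obtain u where "u \<in> X" "v \<rightarrow>\<^bsub>G\<^esub> u" using X by (auto simp: dominating_set_def)
  then show "\<exists>u\<in>g ` X. w \<rightarrow>\<^bsub>H\<^esub> u" using iso sub v by (auto simp: vert_iso_def)
qed

lemma vert_iso_card_verts: "vert_iso G g H \<Longrightarrow> card (verts G) = card (verts H)"
  by (auto simp: vert_iso_def bij_betw_same_card)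

lemma vert_iso_card_image:
  "vert_iso G g H \<Longrightarrow> X \<subseteq> verts G \<Longrightarrow> card (g ` X) = card X"
  by (auto simp: vert_iso_def bij_betw_def intro: card_image inj_on_subset)

lemma (in wf_digraph) arcs_ends_subset_verts: "arcs_ends G \<subseteq> verts G \<times> verts G"
  by (auto simp: arcs_ends_conv)

text \<open>By well-formedness all arcs lie in the squares of the vertex sets, between which
  \<open>map_prod g g\<close> is bijective. This transports edge counts and supplies the arc map of
  an isomorphism.\<close>

lemma vert_iso_bij_arcs_ends:
  assumes iso: "vert_iso G g H" and "wf_digraph G" "wf_digraph H"
  shows "bij_betw (map_prod g g) (arcs_ends G) (arcs_ends H)"
proof -
  note sub = wf_digraph.arcs_ends_subset_verts[OF assms(2)] wf_digraph.arcs_ends_subset_verts[OF assms(3)]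
  have inj: "inj_on g (verts G)" and img: "g ` verts G = verts H"
    and adj: "\<And>u v. u \<in> verts G \<Longrightarrow> v \<in> verts G \<Longrightarrow> u \<rightarrow>\<^bsub>G\<^esub> v \<longleftrightarrow> g u \<rightarrow>\<^bsub>H\<^esub> g v"
    using iso by (auto simp: vert_iso_def bij_betw_def)
  have "inj_on (map_prod g g) (arcs_ends G)"
    by (rule inj_on_subset[OF map_prod_inj_on[OF inj inj] sub(1)])
  moreover have "map_prod g g ` arcs_ends G = arcs_ends H"
  proof
    show "map_prod g g ` arcs_ends G \<subseteq> arcs_ends H" using sub(1) adj by auto
    show "arcs_ends H \<subseteq> map_prod g g ` arcs_ends G"
    proof
      fix e assume e: "e \<in> arcs_ends H"
      then have "e \<in> g ` verts G \<times> g ` verts G" using sub(2) img by auto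
      then obtain u v where "u \<in> verts G" "v \<in> verts G" "e = map_prod g g (u, v)" by auto
      with e adj show "e \<in> map_prod g g ` arcs_ends G" by (metis imageI map_prod_simp)
    qed
  qed
  ultimately show ?thesis by (simp add: bij_betw_def)
qed

lemma digraph_iso_imp_vert_iso:
  assumes "digraph_iso G H"
  obtains g where "vert_iso G g H"
proof -
  from assms obtain f where f: "pre_digraph.digraph_isomorphism G f" "H = app_iso f G"
    by (auto simp: digraph_iso_def)
  then interpret wf_digraph G by (simp add: pre_digraph.digraph_isomorphism_def)
  have inj: "inj_on (iso_verts f) (verts G)" and
    ends: "\<And>e. e \<in> arcs G \<Longrightarrow> iso_verts f (tail G e) = iso_tail f (iso_arcs f e)"
      "\<And>e. e \<in> arcs G \<Longrightarrow> iso_verts f (head G e) = iso_head f (iso_arcs f e)"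
    using f(1) by (auto simp: digraph_isomorphism_def)
  have ends_H: "arcs_ends H = map_prod (iso_verts f) (iso_verts f) ` arcs_ends G"
    by (force simp: f(2) arcs_ends_conv ends image_image)
  have "iso_verts f u \<rightarrow>\<^bsub>H\<^esub> iso_verts f v \<longleftrightarrow> u \<rightarrow>\<^bsub>G\<^esub> v" if "u \<in> verts G" "v \<in> verts G" for u v
    using that inj arcs_ends_subset_verts by (auto simp: ends_H dest!: inj_onD[OF inj])
  moreover have "bij_betw (iso_verts f) (verts G) (verts H)"
    using inj by (simp add: f(2) bij_betw_def)
  ultimately have "vert_iso G (iso_verts f) H" by (simp add: vert_iso_def)
  then show thesis by (rule that)
qed

text \<open>Without parallel arcs an arc is determined by its ends, and the arcs of
  \<open>with_proj H\<close> are pairs of vertices. Hence taking ends and applying \<open>g\<close>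
  to both is an injective arc map.\<close>

lemma (in nomulti_digraph) vert_iso_imp_digraph_iso:
  assumes iso: "vert_iso G g (with_proj H)" and "pair_wf_digraph H"
  shows "digraph_iso G (with_proj H)"
proof -
  interpret H: pair_wf_digraph H by fact
  let ?f = "\<lparr>iso_verts = g, iso_arcs = map_prod g g \<circ> arc_to_ends G, iso_head = snd, iso_tail = fst\<rparr>"
  have bij: "inj_on g (verts G)" "g ` verts G = pverts H"
    using iso by (auto simp: vert_iso_def bij_betw_def)
  have "bij_betw (map_prod g g) (arcs_ends G) (parcs H)"
    using vert_iso_bij_arcs_ends[OF iso wf_digraph H.wf_digraph] by simp
  then have map_arcs: "inj_on (map_prod g g) (arcs_ends G)" "map_prod g g ` arcs_ends G = parcs H"
    by (auto simp: bij_betw_def)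
  then have inj: "inj_on (map_prod g g \<circ> arc_to_ends G) (arcs G)"
    using inj_on_arc_to_ends by (intro comp_inj_on) (simp_all add: arcs_ends_def)
  from map_arcs(2) have "(map_prod g g \<circ> arc_to_ends G) ` arcs G = parcs H"
    by (simp add: image_image arcs_ends_def)
  then have "with_proj H = app_iso ?f G"
    using bij(2) by (simp add: app_iso_def with_proj_def)
  moreover have "digraph_isomorphism ?f"
    using bij(1) inj wf_digraph by (simp add: digraph_isomorphism_def arc_to_ends_def)
  ultimately show ?thesis by (auto simp: digraph_iso_def)
qed

section \<open>Degrees\<close>

lemma (in graph) finite_arcs_ends: "finite (arcs_ends G)"
  by (simp add: arcs_ends_def)

lemma (in graph) finite_neighbours: "finite (arcs_ends G `` {v})"
  using finite_arcs_ends by (rule finite_Image)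

lemma (in graph) dominates_sym: "u \<rightarrow>\<^bsub>G\<^esub> v \<Longrightarrow> v \<rightarrow>\<^bsub>G\<^esub> u"
  using sym_arcs by (rule arcs_ends_symmetric)

text \<open>Double counting: forgetting the order of an arc has fibres of size two, because arcs are
  symmetric and there are no loops.\<close>

lemma (in graph) two_card_uedges: "2 * card (uedges G) = card (arcs_ends G)"
proof -
  let ?h = "\<lambda>(u, v). {u, v}"
  have fiber: "card {a \<in> arcs_ends G. ?h a = e} = 2" if "e \<in> uedges G" for e
  proof -
    from that obtain u v where uv: "e = {u, v}" "u \<rightarrow>\<^bsub>G\<^esub> v" by (auto simp: uedges_def)
    then have "u \<noteq> v" using adj_not_same by auto
    moreover have "{a \<in> arcs_ends G. ?h a = e} = {(u, v), (v, u)}"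
      using uv dominates_sym by (auto simp: doubleton_eq_iff)
    ultimately show ?thesis by simp
  qed
  have "card (arcs_ends G) = (\<Sum>e\<in>?h ` arcs_ends G. card {a \<in> arcs_ends G. ?h a = e})"
    using sum.image_gen[OF finite_arcs_ends, of "\<lambda>_. 1::nat" ?h] by simp
  also have "?h ` arcs_ends G = uedges G" by (force simp: uedges_def)
  finally show ?thesis using fiber by simp
qed

lemma (in graph) sum_degrees: "(\<Sum>v\<in>verts G. card (arcs_ends G `` {v})) = 2 * card (uedges G)"
proof -
  have "arcs_ends G = Sigma (verts G) (\<lambda>v. arcs_ends G `` {v})"
    using arcs_ends_subset_verts by auto
  then have "card (arcs_ends G) = (\<Sum>v\<in>verts G. card (arcs_ends G `` {v}))"
    using card_SigmaI[of "verts G" "\<lambda>v. arcs_ends G `` {v}"] finite_neighbours by simp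
  then show ?thesis by (simp add: two_card_uedges)
qed

section \<open>Connectedness and leaves\<close>

lemma (in graph) connected_closed_set:
  assumes "Digraph_Component.connected G" "a \<in> verts G" "a \<in> S"
    and "\<And>u v. u \<in> S \<Longrightarrow> u \<rightarrow>\<^bsub>G\<^esub> v \<Longrightarrow> v \<in> S"
  shows "verts G \<subseteq> S"
proof
  fix b assume "b \<in> verts G"
  \<comment> \<open>\<open>connected\<close> refers to the symmetric closure, which has the same
    reachability because the arcs are symmetric.\<close>
  then have "a \<rightarrow>\<^sup>*\<^bsub>G\<^esub> b"
    using assms(1,2) reachable_mk_symmetric_eq[OF sym_arcs]
    by (simp add: connected_def strongly_connected_def)
  then show "b \<in> S" by (induction rule: reachable_induct) (use assms(3,4) in auto)
qed

lemma (in graph) neighbours_nonempty: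
  assumes "Digraph_Component.connected G" "card (verts G) \<ge> 2" "v \<in> verts G"
  shows "arcs_ends G `` {v} \<noteq> {}"
proof
  assume "arcs_ends G `` {v} = {}"
  then have "verts G \<subseteq> {v}"
    by (intro connected_closed_set[OF assms(1,3)]) auto
  then have "card (verts G) \<le> 1" using card_mono[of "{v}"] by fastforce
  with assms(2) show False by simp
qed

text \<open>The ends of the chosen shortest path are non-leaves by assumption, and each inner vertex
  has its predecessor and successor as distinct neighbours. The condition \<open>\<noteq> 1\<close>
  counts an isolated vertex as a non-leaf.\<close>

lemma (in graph) weakly_convex_nonleaves:
  assumes "Digraph_Component.connected G"
  shows "weakly_convex G {v \<in> verts G. card (arcs_ends G `` {v}) \<noteq> 1}" (is "weakly_convex G ?X")
  unfolding weakly_convex_def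
proof (intro conjI ballI)
  fix a b assume ab: "a \<in> ?X" "b \<in> ?X"
  then obtain p where p: "shortest_vpath G a p b" "set p \<subseteq> verts G"
    using wcon_dominating_verts(1)[OF _ assms] graph_axioms unfolding weakly_convex_def by blast
  then have walk: "vwalk p G" "distinct p" "hd p = a" "last p = b"
    by (auto simp: shortest_vpath_def vpath_between_def vpath_def)
  have "x \<in> ?X" if "x \<in> set p" for x
  proof -
    obtain i where i: "i < length p" "x = p ! i" using \<open>x \<in> set p\<close> by (auto simp: in_set_conv_nth)
    consider "i = 0" | "Suc i = length p" | "0 < i" "Suc i < length p" using i(1) by linarith
    then show ?thesis
    proof cases
      case 1 then show ?thesis using i walk(3) ab by (simp add: hd_conv_nth)
    next
      case 2
      then have "x = b" using i walk(1,4) by (auto simp: vwalk_iff_nth last_conv_nth simp flip: 2)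
      then show ?thesis using ab by simp
    next
      case 3
      then have "p ! (i - 1) \<rightarrow>\<^bsub>G\<^esub> x" "x \<rightarrow>\<^bsub>G\<^esub> p ! Suc i"
        using walk(1) i unfolding vwalk_iff_nth by (metis Suc_diff_1 Suc_lessD)+
      then have "p ! (i - 1) \<in> arcs_ends G `` {x}" "p ! Suc i \<in> arcs_ends G `` {x}"
        using dominates_sym by auto
      moreover have "p ! (i - 1) \<noteq> p ! Suc i"
        using 3 walk(2) by (simp add: nth_eq_iff_index_eq)
      ultimately have "card (arcs_ends G `` {x}) \<noteq> 1" by (metis card_1_singletonE singletonD)
      then show ?thesis using p(2) that by auto
    qed
  qed
  with p show "\<exists>p. shortest_vpath G a p b \<and> set p \<subseteq> ?X" by blast
qed auto

lemma (in graph) dominating_set_nonleaves: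
  assumes con: "Digraph_Component.connected G" and "card (verts G) \<ge> 3"
  shows "dominating_set G {v \<in> verts G. card (arcs_ends G `` {v}) \<noteq> 1}"
  unfolding dominating_set_def
proof (intro conjI ballI)
  fix v assume v: "v \<in> verts G - {v \<in> verts G. card (arcs_ends G `` {v}) \<noteq> 1}"
  then obtain u where u: "arcs_ends G `` {v} = {u}" using card_1_singletonE by blast
  then have uv: "v \<rightarrow>\<^bsub>G\<^esub> u" "u \<rightarrow>\<^bsub>G\<^esub> v" using dominates_sym by auto
  have "card (arcs_ends G `` {u}) \<noteq> 1"
  proof
    assume "card (arcs_ends G `` {u}) = 1"
    then have "arcs_ends G `` {u} = {v}" using uv by (metis ImageI card_1_singletonE insertI1 singletonD)
    with u have "verts G \<subseteq> {u, v}"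
      using v by (intro connected_closed_set[OF con, of v]) auto
    then have "card (verts G) \<le> card {u, v}" by (rule card_mono[rotated]) simp
    also have "\<dots> \<le> 2" by (simp add: card_insert_if)
    finally show False using assms(2) by simp
  qed
  then show "\<exists>u\<in>{v \<in> verts G. card (arcs_ends G `` {v}) \<noteq> 1}. v \<rightarrow>\<^bsub>G\<^esub> u"
    using uv arcs_ends_subset_verts by blast
qed auto

text \<open>With leaves \<open>?L\<close> and non-leaves \<open>?X\<close>,
  \<open>gamma_wcon G + n\<close> is at most \<open>card ?L + 2 * card ?X\<close>, which is at most
  the degree sum. Keeping \<open>n\<close> on the left avoids truncated subtraction.\<close>

lemma (in graph) gamma_wcon_plus_card_verts:
  assumes con: "Digraph_Component.connected G" and "card (verts G) \<ge> 3"
  shows "gamma_wcon G + card (verts G) \<le> 2 * card (uedges G)"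
    and "gamma_wcon G + card (verts G) = 2 * card (uedges G) \<Longrightarrow> v \<in> verts G \<Longrightarrow>
      card (arcs_ends G `` {v}) \<le> 2"
proof -
  let ?d = "\<lambda>v. card (arcs_ends G `` {v})"
  let ?L = "{v \<in> verts G. ?d v = 1}" and ?X = "{v \<in> verts G. ?d v \<noteq> 1}"
  \<comment> \<open>The least degree possible for a vertex of its kind, once isolated vertices are
    excluded.\<close>
  let ?c = "\<lambda>v. if ?d v = 1 then 1 else 2::nat"
  have part: "card (verts G) = card ?L + card ?X"
    by (subst card_Un_disjoint[symmetric]) (auto intro: arg_cong[where f = card])
  have gamma: "gamma_wcon G \<le> card ?X"
    using weakly_convex_nonleaves[OF con] dominating_set_nonleaves[OF assms]
    by (intro gamma_wcon_le) auto
  have "?d v > 0" if "v \<in> verts G" for v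
    using neighbours_nonempty[OF con _ that] assms(2) finite_neighbours card_gt_0_iff by auto
  then have low: "?c v \<le> ?d v" if "v \<in> verts G" for v
    using that by (fastforce simp: Suc_le_eq)
  have "sum ?c (verts G) = card ?L + 2 * card ?X"
    by (simp add: sum.If_cases Int_def)
  with part gamma have c: "gamma_wcon G + card (verts G) \<le> sum ?c (verts G)" by simp
  also have "\<dots> \<le> 2 * card (uedges G)"
    unfolding sum_degrees[symmetric] using low by (rule sum_mono)
  finally show "gamma_wcon G + card (verts G) \<le> 2 * card (uedges G)" .
  \<comment> \<open>Under equality the sums of \<open>?c\<close> and \<open>?d\<close> agree,
    whereas a vertex of degree at least 3 would make the pointwise bound strict there.\<close>
  assume eq: "gamma_wcon G + card (verts G) = 2 * card (uedges G)" and v: "v \<in> verts G"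
  show "?d v \<le> 2"
  proof (rule ccontr)
    assume "\<not> ?d v \<le> 2"
    then have "\<exists>v\<in>verts G. ?c v < ?d v" using v by (intro bexI[of _ v]) auto
    then have "sum ?c (verts G) < sum ?d (verts G)"
      using low by (intro sum_strict_mono_ex1) auto
    with c eq show False by (simp add: sum_degrees)
  qed
qed

lemma pair_wf_digraph_path_graph: "pair_wf_digraph (path_graph k)"
  by unfold_locales (auto simp: path_graph_def)

lemma pair_wf_digraph_cycle_graph: "pair_wf_digraph (cycle_graph p)"
  by unfold_locales (auto simp: cycle_graph_def)

text \<open>Replacing \<open>mod\<close> by explicit wrap-around cases brings adjacency within reach
  of linear arithmetic.\<close>

lemma parcs_cycle_graph_iff:
  "(i, j) \<in> parcs (cycle_graph p) \<longleftrightarrow> i < p \<and> j < p \<and>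
    (j = Suc i \<or> i = Suc j \<or> i = 0 \<and> Suc j = p \<or> j = 0 \<and> Suc i = p)"
  by (auto simp: cycle_graph_def mod_Suc)

text \<open>Maximality keeps the neighbours of the ends of a longest path inside it, the degree
  bound those of inner vertices; by connectedness the path spans. The only further arc possible
  joins its ends, and its presence decides between cycle and path.\<close>

lemma (in graph) max_degree_2_imp_path_or_cycle:
  assumes con: "Digraph_Component.connected G" and "card (verts G) \<ge> 3"
    and deg: "\<And>v. v \<in> verts G \<Longrightarrow> card (arcs_ends G `` {v}) \<le> 2"
  shows "digraph_iso G (with_proj (path_graph (card (verts G)))) \<or>
    digraph_iso G (with_proj (cycle_graph (card (verts G))))"
proof -
  let ?n = "card (verts G)"
  have bound: "length q < Suc ?n" if "vpath q G" for q
    using that card_mono[of "verts G" "set q"]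
    by (auto simp: vpath_def vwalk_def distinct_card less_Suc_eq_le)
  obtain a where "a \<in> verts G" using assms(2) by fastforce
  then have "vpath [a] G" by (auto simp: vpath_def vwalk_def)
  then obtain p where p: "vpath p G" and longest: "\<And>q. vpath q G \<Longrightarrow> length q \<le> length p"
    using ex_has_greatest_nat[of "\<lambda>q. vpath q G" _ length "Suc ?n"] bound by blast
  then have ne: "p \<noteq> []" and sub: "set p \<subseteq> verts G" and dist: "distinct p"
    and arc: "\<And>i. Suc i < length p \<Longrightarrow> p ! i \<rightarrow>\<^bsub>G\<^esub> p ! Suc i"
    by (auto simp: vpath_def vwalk_iff_nth)
  have hd_nbr: "u \<in> set p" if "hd p \<rightarrow>\<^bsub>G\<^esub> u" for u
  proof (rule ccontr)
    assume "u \<notin> set p"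
    then have "vpath (u # p) G"
      using p vwalk_wf_digraph_consI[of p u] dominates_sym[OF that] by (simp add: vpath_def)
    from longest[OF this] show False by simp
  qed
  have last_nbr: "u \<in> set p" if "last p \<rightarrow>\<^bsub>G\<^esub> u" for u
  proof (rule ccontr)
    assume "u \<notin> set p"
    moreover have "u \<in> verts G" using that arcs_ends_subset_verts by blast
    ultimately have "vpath (p @ [u]) G"
      using p that by (simp add: vpath_def vwalk_def set_vwalk_arcs_snoc[OF ne])
    from longest[OF this] show False by simp
  qed
  have inner_nbr: "u = p ! (i - 1) \<or> u = p ! Suc i"
    if "0 < i" "Suc i < length p" "p ! i \<rightarrow>\<^bsub>G\<^esub> u" for i u
  proof -
    let ?N = "arcs_ends G `` {p ! i}"
    have "p ! (i - 1) \<noteq> p ! Suc i" using that dist by (simp add: nth_eq_iff_index_eq)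
    moreover have "{p ! (i - 1), p ! Suc i} \<subseteq> ?N"
      using arc[of i] arc[of "i - 1"] that dominates_sym by auto
    moreover have "card ?N \<le> 2" using that sub nth_mem[of i p] by (intro deg) auto
    ultimately have "{p ! (i - 1), p ! Suc i} = ?N"
      by (intro card_seteq) (auto simp: finite_neighbours)
    then show ?thesis using that(3) by auto
  qed
  have nbr: "u \<in> set p" if "v \<in> set p" "v \<rightarrow>\<^bsub>G\<^esub> u" for u v
  proof -
    obtain i where i: "i < length p" "v = p ! i" using \<open>v \<in> set p\<close> by (auto simp: in_set_conv_nth)
    consider "i = 0" | "Suc i = length p" | "0 < i" "Suc i < length p" using i(1) by linarith
    then show ?thesis
    proof cases
      case 1 then show ?thesis using hd_nbr that i ne by (simp add: hd_conv_nth)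
    next
      case 2
      then have "last p = v" using ne i by (simp add: last_conv_nth flip: 2)
      then show ?thesis using last_nbr that by simp
    next
      case 3 then show ?thesis using inner_nbr[of i u] that i by auto
    qed
  qed
  have hd: "hd p \<in> set p" using ne by simp
  have "verts G \<subseteq> set p" by (rule connected_closed_set[OF con subsetD[OF sub hd] hd nbr])
  with sub have verts: "set p = verts G" by auto
  then have len: "length p = ?n" using distinct_card[OF dist] by simp
  \<comment> \<open>If \<open>i\<close> or \<open>j\<close> is an inner position,
    \<open>inner\<close> makes them consecutive; otherwise, being different, they are the two
    ends.\<close>
  have adj: "j = Suc i \<or> i = Suc j \<or> i = 0 \<and> Suc j = ?n \<or> j = 0 \<and> Suc i = ?n"
    if "i < ?n" "j < ?n" "p ! i \<rightarrow>\<^bsub>G\<^esub> p ! j" for i j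
  proof -
    have inner: "l = k - 1 \<or> l = Suc k"
      if "0 < k" "Suc k < ?n" "l < ?n" "p ! k \<rightarrow>\<^bsub>G\<^esub> p ! l" for k l
      using inner_nbr[of k "p ! l"] that dist by (auto simp: len nth_eq_iff_index_eq)
    have "i \<noteq> j" using that(3) adj_not_same by metis
    then show ?thesis
      using inner[of i j] inner[of j i] that dominates_sym[OF that(3)] by linarith
  qed
  have bij: "bij_betw ((!) p) {..<?n} (verts G)"
    by (rule bij_betw_nth[OF dist]) (simp_all only: len verts)
  \<comment> \<open>Shared by both cases: only the arcs between path positions have to match. The
    map from positions to vertices goes from \<open>H\<close> to \<open>G\<close> and is then
    inverted.\<close>
  have iso: "digraph_iso G (with_proj H)"
    if H: "pair_wf_digraph H" "pverts H = {..<?n}"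
      and "\<And>i j. i < ?n \<Longrightarrow> j < ?n \<Longrightarrow> (i, j) \<in> parcs H \<longleftrightarrow> p ! i \<rightarrow>\<^bsub>G\<^esub> p ! j" for H
  proof -
    have "vert_iso (with_proj H) ((!) p) G" using bij that by (simp add: vert_iso_def)
    from vert_iso_imp_digraph_iso[OF vert_iso_inv[OF this] H(1)] show ?thesis .
  qed
  have arcs: "p ! i \<rightarrow>\<^bsub>G\<^esub> p ! Suc i" "p ! Suc i \<rightarrow>\<^bsub>G\<^esub> p ! i" if "Suc i < ?n" for i
    using arc[of i] that dominates_sym len by auto
  show ?thesis
  proof (cases "p ! 0 \<rightarrow>\<^bsub>G\<^esub> p ! (?n - 1)")
    case True
    have "p ! i \<rightarrow>\<^bsub>G\<^esub> p ! j" if "i < ?n" "j < ?n"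
      "j = Suc i \<or> i = Suc j \<or> i = 0 \<and> Suc j = ?n \<or> j = 0 \<and> Suc i = ?n" for i j
      using that(3)
    proof (elim disjE conjE)
      assume "i = 0" "Suc j = ?n"
      then have "j = ?n - 1" by simp
      then show ?thesis using True \<open>i = 0\<close> by simp
    next
      assume "j = 0" "Suc i = ?n"
      then have "i = ?n - 1" by simp
      then show ?thesis using dominates_sym[OF True] \<open>j = 0\<close> by simp
    qed (use arcs that in auto)
    with adj have "(i, j) \<in> parcs (cycle_graph ?n) \<longleftrightarrow> p ! i \<rightarrow>\<^bsub>G\<^esub> p ! j"
      if "i < ?n" "j < ?n" for i j
      using that unfolding parcs_cycle_graph_iff by blast
    then have "digraph_iso G (with_proj (cycle_graph ?n))"
      by (intro iso pair_wf_digraph_cycle_graph) (simp_all add: cycle_graph_def)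
    then show ?thesis ..
  next
    case False
    have "p ! i \<rightarrow>\<^bsub>G\<^esub> p ! j \<longleftrightarrow> j = Suc i \<or> i = Suc j" if ij: "i < ?n" "j < ?n" for i j
    proof
      assume a: "p ! i \<rightarrow>\<^bsub>G\<^esub> p ! j"
      have "\<not> (i = 0 \<and> Suc j = ?n)" using a False by (metis diff_Suc_1)
      moreover have "\<not> (j = 0 \<and> Suc i = ?n)" using dominates_sym[OF a] False by (metis diff_Suc_1)
      ultimately show "j = Suc i \<or> i = Suc j" using adj[OF ij a] by auto
    qed (use arcs ij in auto)
    then have "digraph_iso G (with_proj (path_graph ?n))"
      by (intro iso pair_wf_digraph_path_graph) (simp_all add: path_graph_def)
    then show ?thesis ..
  qed
qed

section \<open>Paths and cycles\<close>

text \<open>Dominating the two end vertices puts some \<open>a \<le> 1\<close> and some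
  \<open>b \<ge> k - 2\<close> into \<open>X\<close>. A path between them inside \<open>X\<close>
  cannot skip any number from 1 to \<open>k - 2\<close>.\<close>

lemma card_wcon_dominating_path_graph:
  assumes "k \<ge> 3" and X: "weakly_convex (with_proj (path_graph k)) X"
    "dominating_set (with_proj (path_graph k)) X"
  shows "k - 2 \<le> card X"
proof -
  have sub: "X \<subseteq> {..<k}" using X by (simp add: weakly_convex_def path_graph_def)
  have dom: "v \<in> X \<or> (\<exists>u\<in>X. u = Suc v \<or> v = Suc u)" if "v < k" for v
    using X(2) that by (auto simp: dominating_set_def path_graph_def)
  obtain a where a: "a \<in> X" "a \<le> 1" using dom[of 0] assms(1) by force
  obtain b where b: "b \<in> X" "k - 2 \<le> b" using dom[of "k - 1"] assms(1) by force
  from a b obtain p where p: "shortest_vpath (with_proj (path_graph k)) a p b" "set p \<subseteq> X"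
    using X(1) unfolding weakly_convex_def by blast
  then have walk: "vwalk p (with_proj (path_graph k))" "hd p = a" "last p = b"
    by (auto simp: shortest_vpath_def vpath_between_def vpath_def)
  have "c \<in> X" if "c \<in> {1..k - 2}" for c
  proof -
    have "c \<in> id ` set p"
      using walk(2,3) a b that
      by (intro vwalk_intermediate_value[OF walk(1)]) (auto simp: path_graph_def)
    with p(2) show ?thesis by auto
  qed
  then have "card {1..k - 2} \<le> card X"
    using sub by (intro card_mono) (auto intro: finite_subset)
  then show ?thesis by simp
qed

text \<open>The symmetry that carries a statement about vertex 0 to every vertex. The case
  \<open>i = 0\<close> is the wrap-around, where truncated subtraction would give 0.\<close>

lemma cycle_graph_rotation:
  "vert_iso (with_proj (cycle_graph p)) (\<lambda>i. if i = 0 then p - 1 else i - 1) (with_proj (cycle_graph p))"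
proof -
  let ?r = "\<lambda>i. if i = 0 then p - 1 else i - 1"
  have "bij_betw ?r {..<p} {..<p}"
    by (rule bij_betw_byWitness[where f' = "\<lambda>i. if Suc i = p then 0 else Suc i"]) auto
  moreover have "(i, j) \<in> parcs (cycle_graph p) \<longleftrightarrow> (?r i, ?r j) \<in> parcs (cycle_graph p)"
    if "i < p" "j < p" for i j
    using that unfolding parcs_cycle_graph_iff by auto
  ultimately show ?thesis by (simp add: vert_iso_def cycle_graph_def)
qed

lemma zero_in_wcon_dominating_cycle_graph:
  assumes "p \<ge> 7" and X: "weakly_convex (with_proj (cycle_graph p)) X"
    "dominating_set (with_proj (cycle_graph p)) X"
  shows "0 \<in> X"
proof (rule ccontr)
  let ?C = "with_proj (cycle_graph p)"
  assume "0 \<notin> X"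
  have dom: "v \<in> X \<or> (\<exists>u\<in>X. (v, u) \<in> parcs (cycle_graph p))" if "v < p" for v
    using X(2) that by (auto simp: dominating_set_def cycle_graph_def)
  have near_1: "1 \<in> X \<or> 2 \<in> X"
    using dom[of 1] assms(1) \<open>0 \<notin> X\<close> by (auto simp: parcs_cycle_graph_iff numeral_2_eq_2)
  have near_p: "p - 1 \<in> X \<or> p - 2 \<in> X"
  proof -
    have "u = 0 \<or> u = p - 2" if "(p - 1, u) \<in> parcs (cycle_graph p)" for u
      using that assms(1) unfolding parcs_cycle_graph_iff by linarith
    then show ?thesis using dom[of "p - 1"] assms(1) \<open>0 \<notin> X\<close> by fastforce
  qed
  have near_0: "1 \<in> X \<or> p - 1 \<in> X"
    using dom[of 0] assms(1) \<open>0 \<notin> X\<close> by (auto simp: parcs_cycle_graph_iff)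
  have paths: "vpath_between ?C 1 [1, 0, p - 1] (p - 1)" "vpath_between ?C 2 [2, 1, 0, p - 1] (p - 1)"
    "vpath_between ?C 1 [1, 0, p - 1, p - 2] (p - 2)"
    using assms(1)
    by (auto simp: vpath_between_def vpath_def vwalk_def parcs_cycle_graph_iff,
        auto simp: cycle_graph_def)
  \<comment> \<open>Of the four combinations offered by \<open>near_1\<close> and
    \<open>near_p\<close>, \<open>near_0\<close> excludes having only 2 and
    \<open>p - 2\<close>.\<close>
  consider "1 \<in> X" "p - 1 \<in> X" | "2 \<in> X" "p - 1 \<in> X" | "1 \<in> X" "p - 2 \<in> X"
    using near_1 near_p near_0 by blast
  \<comment> \<open>The smallest gap \<open>b - a\<close> is \<open>p - 3\<close>, which reaches 4
    exactly from \<open>p = 7\<close> on; the paths through 0 have at most 3 edges.\<close>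
  then obtain a b q where ab: "a \<in> X" "b \<in> X" "a + 4 \<le> b"
    and q: "vpath_between ?C a q b" "vwalk_length q \<le> 3"
  proof cases
    case 1 then show thesis using that[OF 1 _ paths(1)] assms(1) by simp
  next
    case 2 then show thesis using that[OF 2 _ paths(2)] assms(1) by simp
  next
    case 3 then show thesis using that[OF 3 _ paths(3)] assms(1) by simp
  qed
  from ab X(1) obtain w where w: "shortest_vpath ?C a w b" "set w \<subseteq> X"
    unfolding weakly_convex_def by blast
  then have "vwalk w ?C" "hd w = a" "last w = b" "vwalk_length w \<le> vwalk_length q"
    using q(1) by (auto simp: shortest_vpath_def vpath_between_def vpath_def)
  moreover have "\<bar>int u - int v\<bar> \<le> 1" if "u \<in> X" "v \<in> X" "u \<rightarrow>\<^bsub>?C\<^esub> v" for u v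
    using that \<open>0 \<notin> X\<close> by (auto simp: parcs_cycle_graph_iff)
  ultimately show False
    using vwalk_lipschitz[of w ?C X int] w(2) ab(3) q(2) by fastforce
qed

text \<open>Induction on the vertex \<open>c\<close> over all \<open>X\<close> at once: rotating
  \<open>X\<close> back by one keeps the hypotheses and moves \<open>Suc c\<close> to
  \<open>c\<close>, down to the case of 0.\<close>

lemma wcon_dominating_cycle_graph:
  assumes "p \<ge> 7" and X: "weakly_convex (with_proj (cycle_graph p)) X"
    "dominating_set (with_proj (cycle_graph p)) X"
  shows "X = {..<p}"
proof
  show "X \<subseteq> {..<p}" using X by (simp add: weakly_convex_def cycle_graph_def)
  have "c < p \<longrightarrow> c \<in> X" for c
    using X
  proof (induction c arbitrary: X)
    case 0
    then show ?case using zero_in_wcon_dominating_cycle_graph[OF assms(1)] by simp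
  next
    case (Suc c)
    let ?r = "\<lambda>i. if i = 0 then p - 1 else i - 1"
    have "c < p \<longrightarrow> c \<in> ?r ` X"
      using Suc.prems vert_iso_weakly_convex[OF cycle_graph_rotation]
        vert_iso_dominating_set[OF cycle_graph_rotation] by (intro Suc.IH) auto
    \<comment> \<open>The preimage of \<open>c\<close> is \<open>Suc c\<close>, except that
      \<open>p - 1\<close> comes from 0; \<open>Suc c < p\<close> rules that out.\<close>
    then show ?case by (auto split: if_splits)
  qed
  then show "{..<p} \<subseteq> X" by auto
qed

text \<open>
  For \<open>p \<le> 6\<close> an arc of \<open>p - 2\<close> vertices has at most \<open>p div 2\<close> edges, hence is a geodesic. The
  distance from \<open>a\<close> is certified by the 1-Lipschitz function \<open>min d (p - d)\<close> with \<open>d = \<bar>t - a\<bar>\<close>.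
\<close>

lemma weakly_convex_small_cycle_graph:
  assumes "p \<le> 6"
  shows "weakly_convex (with_proj (cycle_graph p)) {..<p - 2}"
  unfolding weakly_convex_def
proof (intro conjI ballI)
  let ?C = "with_proj (cycle_graph p)"
  show "{..<p - 2} \<subseteq> verts ?C" by (auto simp: cycle_graph_def)
  fix a b assume ab: "a \<in> {..<p - 2}" "b \<in> {..<p - 2}"
  let ?p = "if a \<le> b then [a..<Suc b] else rev [b..<Suc a]"
  let ?h = "\<lambda>t. min \<bar>int t - int a\<bar> (int p - \<bar>int t - int a\<bar>)"
  have "vpath_between ?C a ?p b"
  proof (cases "a \<le> b")
    case True
    have "vwalk [a..<Suc b] ?C"
      unfolding vwalk_iff_nth using ab True
      by (auto simp: parcs_cycle_graph_iff cycle_graph_def nth_append simp del: upt_Suc)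
    with True show ?thesis
      by (simp add: vpath_between_def vpath_def hd_conv_nth nth_append del: upt_Suc)
  next
    case False
    have "vwalk (rev [b..<Suc a]) ?C"
      unfolding vwalk_iff_nth using ab False
      by (auto simp: parcs_cycle_graph_iff cycle_graph_def rev_nth simp del: upt_Suc)
    with False show ?thesis
      by (simp add: vpath_between_def vpath_def last_rev hd_rev del: upt_Suc)
  qed
  moreover have "\<bar>?h u - ?h v\<bar> \<le> 1" if "u \<rightarrow>\<^bsub>?C\<^esub> v" for u v
    using that ab unfolding with_proj_simps parcs_cycle_graph_iff
    by (auto simp: min_def abs_if split: if_splits)
  \<comment> \<open>Here \<open>?h a\<close> is 0. The distance of the numbers \<open>a\<close> and
    \<open>b\<close> is at most \<open>p - 3\<close>, hence at most 3, while \<open>p\<close> minus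
    it is at least 3; so \<open>?h b\<close> is the number of edges of \<open>?p\<close>.\<close>
  moreover have "int (vwalk_length ?p) \<le> \<bar>?h a - ?h b\<bar>"
    using ab assms by auto
  ultimately have "shortest_vpath ?C a ?p b" by (rule shortest_vpathI_lipschitz)
  moreover have "set ?p \<subseteq> {..<p - 2}" using ab by auto
  ultimately show "\<exists>q. shortest_vpath ?C a q b \<and> set q \<subseteq> {..<p - 2}" by blast
qed

text \<open>The omitted vertices \<open>p - 2\<close> and \<open>p - 1\<close> are next to the ends
  \<open>p - 3\<close> and 0 of the arc; these ends coincide for \<open>p = 3\<close>.\<close>

lemma dominating_set_cycle_graph:
  assumes "p \<ge> 3"
  shows "dominating_set (with_proj (cycle_graph p)) {..<p - 2}"
  unfolding dominating_set_def
proof (intro conjI ballI)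
  show "{..<p - 2} \<subseteq> verts (with_proj (cycle_graph p))" by (auto simp: cycle_graph_def)
  fix v assume "v \<in> verts (with_proj (cycle_graph p)) - {..<p - 2}"
  then consider "v = p - 2" | "v = p - 1" by (force simp: cycle_graph_def)
  then show "\<exists>u\<in>{..<p - 2}. v \<rightarrow>\<^bsub>with_proj (cycle_graph p)\<^esub> u"
  proof cases
    case 1
    then show ?thesis
      using assms by (intro bexI[of _ "p - 3"]) (auto simp: parcs_cycle_graph_iff)
  next
    case 2
    then show ?thesis
      using assms by (intro bexI[of _ 0]) (auto simp: parcs_cycle_graph_iff)
  qed
qed

section \<open>Edge counts and the final evaluation\<close>

lemma card_parcs_path_graph: "card (parcs (path_graph k)) = 2 * (k - 1)"
proof -
  let ?f = "\<lambda>i::nat. (i, Suc i)" and ?g = "\<lambda>i::nat. (Suc i, i)"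
  have "parcs (path_graph k) = ?f ` {..<k - 1} \<union> ?g ` {..<k - 1}"
    by (auto simp: path_graph_def)
  moreover have "card (?f ` {..<k - 1} \<union> ?g ` {..<k - 1}) = card (?f ` {..<k - 1}) + card (?g ` {..<k - 1})"
    by (intro card_Un_disjoint) auto
  moreover have "inj_on ?f {..<k - 1}" "inj_on ?g {..<k - 1}" by (auto simp: inj_on_def)
  ultimately show ?thesis by (simp add: card_image)
qed

text \<open>Each vertex contributes one forward and one backward arc. The two families are disjoint
  because \<open>i + 2\<close> and \<open>i\<close> differ modulo \<open>p\<close> when
  \<open>p \<ge> 3\<close>.\<close>

lemma card_parcs_cycle_graph:
  assumes "p \<ge> 3"
  shows "card (parcs (cycle_graph p)) = 2 * p"
proof -
  let ?s = "\<lambda>i. (i + 1) mod p"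
  let ?f = "\<lambda>i. (i, ?s i)" and ?g = "\<lambda>i. (?s i, i)"
  have "parcs (cycle_graph p) = ?f ` {..<p} \<union> ?g ` {..<p}"
    using assms by (auto simp: cycle_graph_def)
  moreover have "card (?f ` {..<p} \<union> ?g ` {..<p}) = card (?f ` {..<p}) + card (?g ` {..<p})"
    using assms by (intro card_Un_disjoint) (auto simp: mod_Suc split: if_splits)
  moreover have "inj_on ?f {..<p}" "inj_on ?g {..<p}" by (auto simp: inj_on_def)
  ultimately show ?thesis by (simp add: card_image)
qed

lemma (in graph) two_card_uedges_iso:
  assumes "vert_iso G g (with_proj H)" "pair_wf_digraph H"
  shows "2 * card (uedges G) = card (parcs H)"
proof -
  interpret H: pair_wf_digraph H by fact
  from bij_betw_same_card[OF vert_iso_bij_arcs_ends[OF assms(1) wf_digraph H.wf_digraph]]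
  show ?thesis by (simp add: two_card_uedges)
qed

theorem theorem2p3:
  fixes G :: "('a, 'b) pre_digraph" and n m :: nat
  assumes "graph G" and "Digraph_Component.connected G"
    and "n = card (verts G)" and "n \<ge> 3" and "m = card (uedges G)"
  shows "int (gamma_wcon G) \<le> 2 * int m - int n \<and>
    (int (gamma_wcon G) = 2 * int m - int n \<longleftrightarrow>
      (\<exists>k. digraph_iso G (with_proj (path_graph k))) \<or>
      (\<exists>p\<ge>7. digraph_iso G (with_proj (cycle_graph p))))"
proof -
  interpret graph G by fact
  note con = assms(2)
  have n: "card (verts G) \<ge> 3" using assms by simp
  have le: "gamma_wcon G + n \<le> 2 * m"
    using gamma_wcon_plus_card_verts(1)[OF con n] assms by simp
  have sub: "X \<subseteq> verts G" if "weakly_convex G X" for X using that by (simp add: weakly_convex_def)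
  have path: "gamma_wcon G + n = 2 * m" if iso: "digraph_iso G (with_proj (path_graph k))" for k
  proof -
    obtain g where g: "vert_iso G g (with_proj (path_graph k))"
      using digraph_iso_imp_vert_iso[OF iso] .
    have "k = n" using vert_iso_card_verts[OF g] assms by (simp add: path_graph_def)
    have "2 * m = 2 * (k - 1)"
      using two_card_uedges_iso[OF g pair_wf_digraph_path_graph] card_parcs_path_graph assms by simp
    \<comment> \<open>With \<open>k = n\<close>, the target value \<open>2 * m - n\<close> is
      \<open>k - 2\<close>; \<open>le\<close> supplies the opposite inequality.\<close>
    moreover have "k - 2 \<le> gamma_wcon G"
    proof (rule gamma_wcon_ge[OF assms(1) con])
      fix X assume X: "weakly_convex G X" "dominating_set G X"
      have "k - 2 \<le> card (g ` X)"
        using card_wcon_dominating_path_graph[OF _ vert_iso_weakly_convex[OF g X(1)]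
            vert_iso_dominating_set[OF g X(2)]] \<open>k = n\<close> assms(4) by simp
      then show "k - 2 \<le> card X" using vert_iso_card_image[OF g sub[OF X(1)]] by simp
    qed
    ultimately show ?thesis using le \<open>k = n\<close> assms(4) by simp
  qed
  have cycle: "gamma_wcon G + n = 2 * m \<longleftrightarrow> p \<ge> 7" if iso: "digraph_iso G (with_proj (cycle_graph p))" for p
  proof -
    obtain g where g: "vert_iso G g (with_proj (cycle_graph p))"
      using digraph_iso_imp_vert_iso[OF iso] .
    have p: "p = n" using vert_iso_card_verts[OF g] assms by (simp add: cycle_graph_def)
    then have m: "2 * m = 2 * n"
      using two_card_uedges_iso[OF g pair_wf_digraph_cycle_graph] card_parcs_cycle_graph assms by simp
    show ?thesis
    proof
      assume "p \<ge> 7"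
      have "p \<le> gamma_wcon G"
      proof (rule gamma_wcon_ge[OF assms(1) con])
        fix X assume X: "weakly_convex G X" "dominating_set G X"
        have "g ` X = {..<p}"
          using wcon_dominating_cycle_graph[OF \<open>p \<ge> 7\<close> vert_iso_weakly_convex[OF g X(1)]
              vert_iso_dominating_set[OF g X(2)]] .
        then show "p \<le> card X" using vert_iso_card_image[OF g sub[OF X(1)]] by simp
      qed
      then show "gamma_wcon G + n = 2 * m" using le p m by simp
    next
      assume eq: "gamma_wcon G + n = 2 * m"
      show "p \<ge> 7"
      proof (rule ccontr)
        assume "\<not> p \<ge> 7"
        then have p': "p \<le> 6" "p \<ge> 3" using p assms(4) by auto
        let ?g = "inv_into (verts G) g"
        have inv: "vert_iso (with_proj (cycle_graph p)) ?g G" using g by (rule vert_iso_inv)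
        \<comment> \<open>The arc of \<open>p - 2\<close> vertices, carried over to
          \<open>G\<close>, is smaller than \<open>p\<close>, which is the value of
          \<open>2 * m - n\<close> on a cycle.\<close>
        have "gamma_wcon G \<le> card (?g ` {..<p - 2})"
          using vert_iso_weakly_convex[OF inv weakly_convex_small_cycle_graph[OF p'(1)]]
            vert_iso_dominating_set[OF inv dominating_set_cycle_graph[OF p'(2)]]
          by (intro gamma_wcon_le) auto
        also have "\<dots> \<le> p - 2" using card_image_le[of "{..<p - 2}" ?g] by simp
        finally show False using eq m p p' by simp
      qed
    qed
  qed
  have "gamma_wcon G + n = 2 * m \<longleftrightarrow> (\<exists>k. digraph_iso G (with_proj (path_graph k))) \<or>
      (\<exists>p\<ge>7. digraph_iso G (with_proj (cycle_graph p)))"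
  proof
    assume eq: "gamma_wcon G + n = 2 * m"
    then have "card (arcs_ends G `` {v}) \<le> 2" if "v \<in> verts G" for v
      using gamma_wcon_plus_card_verts(2)[OF con n _ that] assms by simp
    \<comment> \<open>In the cycle case, \<open>cycle\<close> together with \<open>eq\<close> yields
      \<open>p \<ge> 7\<close>.\<close>
    from max_degree_2_imp_path_or_cycle[OF con n this] cycle eq
    show "(\<exists>k. digraph_iso G (with_proj (path_graph k))) \<or>
      (\<exists>p\<ge>7. digraph_iso G (with_proj (cycle_graph p)))" by blast
  qed (use path cycle in blast)
  moreover have "int (gamma_wcon G) = 2 * int m - int n \<longleftrightarrow> gamma_wcon G + n = 2 * m" by linarith
  ultimately show ?thesis using le by simp
qed

end
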